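(* Let $\mu$ be the measure on $\mathbb{C}$ supported on $[-1,1]\subset\mathbb{R}$ given by $d\mu(x)=\frac{1}{\pi}(1-x^2)^{-1/2}dx$. Then $\mu$ is reflectionless, and its Cauchy maximal function $C^{\mu}_*$ belongs to weak $L^1(|\mu|)$, i.e. there is a constant $K<\infty$ such that $|\mu|(\{z: C^{\mu}_*(z)>\lambda\})\le K/\lambda$ for all $\lambda>0$.
   Context: For a finite complex Borel measure $\mu$ on $\mathbb{C}$, $\varepsilon>0$ and $z\in\mathbb{C}$, put $C^{\mu}_{\varepsilon}(z)=\int_{|\zeta-z|>\varepsilon}\frac{d\mu(\zeta)}{\zeta-z}$, $C^{\mu}(z)=\lim_{\varepsilon\to 0}C^{\mu}_{\varepsilon}(z)$ whenever the limit exists, and $C^{\mu}_*(z)=\sup_{\varepsilon>0}|C^{\mu}_{\varepsilon}(z)|$. A nontrivial finite complex measure $\mu$ without atoms is called reflectionless if $C^{\mu}(z)$ exists and equals $0$ for $|\mu|$-almost every $z$. *)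

theory Defs
  imports "HOL-Analysis.Analysis"
begin

text \<open>
  A complex Borel measure on the plane is represented by its set function, of which only the values
  on Borel sets matter. As usual, finiteness of the total variation is automatic, and the empty set
  gets measure \<open>0\<close> because a constant complex series converges only if it vanishes.
\<close>

definition complex_borel_measure :: "(complex set \<Rightarrow> complex) \<Rightarrow> bool" where
  "complex_borel_measure \<nu> \<longleftrightarrow>
     (\<forall>A :: nat \<Rightarrow> complex set. range A \<subseteq> sets borel \<longrightarrow> disjoint_family A \<longrightarrow>
        (\<lambda>i. \<nu> (A i)) sums \<nu> (\<Union>i. A i))"

definition total_variation :: "(complex set \<Rightarrow> complex) \<Rightarrow> complex measure" where
  "total_variation \<nu> = measure_of UNIV (sets borel)
     (\<lambda>E. SUP A \<in> {A :: nat \<Rightarrow> complex set.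
                      range A \<subseteq> sets borel \<and> disjoint_family A \<and> (\<Union>i. A i) = E}.
            \<Sum>i. ennreal (cmod (\<nu> (A i))))"

text \<open>
  The positive part of the Jordan decomposition of a real signed measure; \<open>ennreal\<close> sends negative
  numbers to \<open>0\<close>, which is harmless since the empty set is among the competitors.
  The negative part of \<open>\<sigma>\<close> is the positive part of \<open>- \<sigma>\<close>.
\<close>

definition upper_variation :: "(complex set \<Rightarrow> real) \<Rightarrow> complex measure" where
  "upper_variation \<sigma> = measure_of UNIV (sets borel)
     (\<lambda>E. SUP F \<in> {F \<in> sets borel. F \<subseteq> E}. ennreal (\<sigma> F))"

definition signed_integral :: "(complex set \<Rightarrow> real) \<Rightarrow> (complex \<Rightarrow> complex) \<Rightarrow> complex" where
  "signed_integral \<sigma> f =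
     integral\<^sup>L (upper_variation \<sigma>) f - integral\<^sup>L (upper_variation (\<lambda>E. - \<sigma> E)) f"

definition complex_measure_integral ::
    "(complex set \<Rightarrow> complex) \<Rightarrow> (complex \<Rightarrow> complex) \<Rightarrow> complex" where
  "complex_measure_integral \<nu> f =
     signed_integral (\<lambda>E. Re (\<nu> E)) f + \<i> * signed_integral (\<lambda>E. Im (\<nu> E)) f"

definition truncated_cauchy :: "(complex set \<Rightarrow> complex) \<Rightarrow> real \<Rightarrow> complex \<Rightarrow> complex" where
  "truncated_cauchy \<nu> \<epsilon> z =
     complex_measure_integral \<nu> (\<lambda>\<zeta>. indicator {\<zeta>. cmod (\<zeta> - z) > \<epsilon>} \<zeta> * (1 / (\<zeta> - z)))"

definition cauchy_transform_exists :: "(complex set \<Rightarrow> complex) \<Rightarrow> complex \<Rightarrow> bool" where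
  "cauchy_transform_exists \<nu> z \<longleftrightarrow>
     (\<exists>l. ((\<lambda>\<epsilon>. truncated_cauchy \<nu> \<epsilon> z) \<longlongrightarrow> l) (at_right 0))"

definition cauchy_transform :: "(complex set \<Rightarrow> complex) \<Rightarrow> complex \<Rightarrow> complex" where
  "cauchy_transform \<nu> z = Lim (at_right 0) (\<lambda>\<epsilon>. truncated_cauchy \<nu> \<epsilon> z)"

definition cauchy_maximal :: "(complex set \<Rightarrow> complex) \<Rightarrow> complex \<Rightarrow> ennreal" where
  "cauchy_maximal \<nu> z = (SUP \<epsilon> \<in> {0<..}. ennreal (cmod (truncated_cauchy \<nu> \<epsilon> z)))"

definition reflectionless :: "(complex set \<Rightarrow> complex) \<Rightarrow> bool" where
  "reflectionless \<nu> \<longleftrightarrow>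
     complex_borel_measure \<nu> \<and>
     (\<exists>E \<in> sets borel. \<nu> E \<noteq> 0) \<and>
     (\<forall>z. \<nu> {z} = 0) \<and>
     (AE z in total_variation \<nu>. cauchy_transform_exists \<nu> z \<and> cauchy_transform \<nu> z = 0)"

text \<open>
  Measurability is part of the definition: \<open>emeasure\<close> is \<open>0\<close> on non-measurable sets, so the
  bound alone would say nothing for a non-measurable function.
\<close>

definition weak_L1 :: "'a measure \<Rightarrow> ('a \<Rightarrow> ennreal) \<Rightarrow> bool" where
  "weak_L1 M f \<longleftrightarrow>
     f \<in> borel_measurable M \<and>
     (\<exists>K::real. \<forall>t>0. emeasure M {z \<in> space M. f z > ennreal t} \<le> ennreal (K / t))"

definition complex_measure_of :: "complex measure \<Rightarrow> complex set \<Rightarrow> complex" where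
  "complex_measure_of M E = complex_of_real (measure M E)"

definition arcsine_measure :: "complex measure" where
  "arcsine_measure =
     distr (density lborel
              (\<lambda>x::real. ennreal (indicator {-1..1} x * (1 / pi * (1 - x\<^sup>2) powr (-1/2)))))
           borel complex_of_real"

end

(*
  In the coordinates x = cos theta, t = cos s the measure is d s / pi on [0, pi] and the kernel
  1 / (cos s - cos theta) has the elementary primitive
  ln |sin ((s + theta)/2) / sin ((s - theta)/2)| / sin theta, which vanishes at s = 0 and s = pi.
  Hence a truncated Cauchy integral at x is (G (x + eps) - G (x - eps)) / (pi sqrt (1 - x^2)), where
  G is this logarithm and both arguments are clipped to [-1, 1]. The singularities of the two terms
  at x cancel, so the difference tends to 0, and it is bounded by ln 6 uniformly in x and eps. The
  maximal function is therefore at most a multiple of (1 - x^2)^(-1/2), which lies in weak L^1 of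
  the measure: the set where sin theta < q has measure O(q).
*)

theory Submission
  imports Defs
begin

subsection \<open>Complex measures given by finite positive measures\<close>

text \<open>By countable additivity every Borel partition of E yields the same sum, so the supremum
  runs over a constant.\<close>

lemma total_variation_complex_measure_of:
  assumes "finite_measure M" and sets_M: "sets M = sets borel"
  shows "total_variation (complex_measure_of M) = M"
proof -
  interpret finite_measure M by fact
  have space_M: "space M = UNIV"
    using sets_eq_imp_space_eq[OF sets_M] by simp
  have "(SUP A \<in> {A :: nat \<Rightarrow> complex set.
             range A \<subseteq> sets borel \<and> disjoint_family A \<and> (\<Union>i. A i) = E}.
           \<Sum>i. ennreal (cmod (complex_measure_of M (A i)))) = emeasure M E"
    (is "(SUP A \<in> ?P. ?s A) = _") if "E \<in> sets borel" for E
  proof -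
    have eq: "?s A = emeasure M E" if "A \<in> ?P" for A
    proof -
      have "?s A = (\<Sum>i. emeasure M (A i))"
        by (simp add: complex_measure_of_def emeasure_eq_measure)
      also have "\<dots> = emeasure M E"
        using that by (subst suminf_emeasure) (auto simp: sets_M)
      finally show ?thesis .
    qed
    \<comment> \<open>A supremum of a constant family equals the constant only if the family is
      nonempty; the partition E, {}, {}, ... witnesses this.\<close>
    have "(\<lambda>i. if i = 0 then E else {}) \<in> ?P"
      using that by (auto simp: disjoint_family_on_def split: if_splits)
    then have "?P \<noteq> {}" by blast
    then show ?thesis
      by (rule SUP_eq_const) (rule eq)
  qed
  then have "total_variation (complex_measure_of M) = measure_of UNIV (sets borel) (emeasure M)"
    unfolding total_variation_def
    by (intro measure_of_eq) (auto simp: sets.sigma_sets_eq[of borel, simplified])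
  also have "\<dots> = M"
    using measure_of_of_measure[of M] by (simp add: sets_M space_M)
  finally show ?thesis .
qed

text \<open>Monotonicity makes F = E the best competitor in the supremum.\<close>

lemma upper_variation_measure:
  assumes "finite_measure M" and sets_M: "sets M = sets borel"
  shows "upper_variation (measure M) = M"
proof -
  interpret finite_measure M by fact
  have space_M: "space M = UNIV"
    using sets_eq_imp_space_eq[OF sets_M] by simp
  have "(SUP F \<in> {F \<in> sets borel. F \<subseteq> E}. ennreal (measure M F)) = emeasure M E"
    if "E \<in> sets borel" for E
  proof (rule antisym)
    show "(SUP F \<in> {F \<in> sets borel. F \<subseteq> E}. ennreal (measure M F)) \<le> emeasure M E"
      using that by (intro SUP_least) (auto simp: emeasure_eq_measure sets_M intro!: finite_measure_mono)
    show "emeasure M E \<le> (SUP F \<in> {F \<in> sets borel. F \<subseteq> E}. ennreal (measure M F))"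
      using that by (intro SUP_upper2[of E]) (auto simp: emeasure_eq_measure)
  qed
  then have "upper_variation (measure M) = measure_of UNIV (sets borel) (emeasure M)"
    unfolding upper_variation_def
    by (intro measure_of_eq) (auto simp: sets.sigma_sets_eq[of borel, simplified])
  also have "\<dots> = M"
    using measure_of_of_measure[of M] by (simp add: sets_M space_M)
  finally show ?thesis .
qed

text \<open>Disposes of three of the four Jordan parts of a positive measure: the negative part of
  the real part and both parts of the vanishing imaginary part.\<close>

lemma upper_variation_nonpos:
  assumes "\<And>E. \<sigma> E \<le> 0"
  shows "upper_variation \<sigma> = null_measure borel"
proof -
  have "(SUP F \<in> {F \<in> sets borel. F \<subseteq> E}. ennreal (\<sigma> F)) = 0" for E :: "complex set"
    by (rule SUP_eq_const) (auto simp: ennreal_eq_0_iff assms)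
  then have "upper_variation \<sigma> = measure_of UNIV (sets borel) (\<lambda>_. 0)"
    unfolding upper_variation_def by simp
  then show ?thesis
    by (simp add: null_measure_def)
qed

lemma complex_measure_integral_complex_measure_of:
  assumes "finite_measure M" "sets M = sets borel"
  shows "complex_measure_integral (complex_measure_of M) f = integral\<^sup>L M f"
  by (simp add: complex_measure_integral_def signed_integral_def complex_measure_of_def
      upper_variation_measure[OF assms] upper_variation_nonpos)

lemma truncated_cauchy_complex_measure_of:
  assumes "finite_measure M" "sets M = sets borel"
  shows "truncated_cauchy (complex_measure_of M) \<epsilon> z =
    (\<integral>\<zeta>. (if cmod (\<zeta> - z) > \<epsilon> then 1 / (\<zeta> - z) else 0) \<partial>M)"
  unfolding truncated_cauchy_def complex_measure_integral_complex_measure_of[OF assms]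
  by (intro Bochner_Integration.integral_cong) (auto simp: indicator_def)

section \<open>Measurability of the Cauchy maximal function\<close>

lemma borel_measurable_truncated_cauchy:
  assumes "finite_measure M" "sets M = sets borel"
  shows "truncated_cauchy (complex_measure_of M) \<epsilon> \<in> borel_measurable borel"
proof -
  interpret finite_measure M by fact
  note assms(2)[measurable_cong]
  show ?thesis
    unfolding truncated_cauchy_complex_measure_of[OF assms, abs_def]
    by measurable
qed

text \<open>The strict inequality in the truncation makes the integrands converge pointwise when the
  radius decreases to its limit. They are dominated by the constant 1/\<epsilon>, which is
  integrable against a finite measure.\<close>

lemma truncated_cauchy_tendsto_from_above:
  assumes "finite_measure M" and sets_M: "sets M = sets borel"
    and "\<epsilon> > 0" "r \<longlonglongrightarrow> \<epsilon>" "\<And>n. r n > \<epsilon>"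
  shows "(\<lambda>n. truncated_cauchy (complex_measure_of M) (r n) z)
           \<longlonglongrightarrow> truncated_cauchy (complex_measure_of M) \<epsilon> z"
  unfolding truncated_cauchy_complex_measure_of[OF assms(1,2)]
proof (rule integral_dominated_convergence[where w = "\<lambda>_. 1 / \<epsilon>"])
  interpret finite_measure M by fact
  note sets_M[measurable_cong]
  show "(\<lambda>\<zeta>. if cmod (\<zeta> - z) > \<epsilon> then 1 / (\<zeta> - z) else 0) \<in> borel_measurable M"
    "(\<lambda>\<zeta>. if cmod (\<zeta> - z) > r n then 1 / (\<zeta> - z) else 0) \<in> borel_measurable M" for n
    by measurable
  show "integrable M (\<lambda>_. 1 / \<epsilon>)" by simp
  show "AE \<zeta> in M. norm (if cmod (\<zeta> - z) > r n then 1 / (\<zeta> - z) else 0) \<le> 1 / \<epsilon>" for n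
    using assms(3) assms(5)[of n] by (intro AE_I2) (simp add: norm_divide frac_le)
  show "AE \<zeta> in M. (\<lambda>n. if cmod (\<zeta> - z) > r n then 1 / (\<zeta> - z) else 0)
          \<longlonglongrightarrow> (if cmod (\<zeta> - z) > \<epsilon> then 1 / (\<zeta> - z) else 0)"
  proof (intro AE_I2)
    fix \<zeta>
    show "(\<lambda>n. if cmod (\<zeta> - z) > r n then 1 / (\<zeta> - z) else 0)
          \<longlonglongrightarrow> (if cmod (\<zeta> - z) > \<epsilon> then 1 / (\<zeta> - z) else 0)"
    proof (cases "cmod (\<zeta> - z) > \<epsilon>")
      case True
      have "eventually (\<lambda>n. r n < cmod (\<zeta> - z)) sequentially"
        using True assms(4) by (rule order_tendstoD(2)[rotated])
      then show ?thesis
        by (rule tendsto_eventually[OF eventually_mono]) (use True in auto)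
    next
      case False
      then have "\<not> cmod (\<zeta> - z) > r n" for n
        using assms(5)[of n] by simp
      then show ?thesis
        using False by simp
    qed
  qed
qed

text \<open>Right-continuity in the radius reduces the uncountable supremum to a countable one,
  which preserves measurability.\<close>

lemma cauchy_maximal_eq_SUP_Rats:
  assumes "finite_measure M" "sets M = sets borel"
  shows "cauchy_maximal (complex_measure_of M) z =
    (SUP \<epsilon> \<in> {0<..} \<inter> \<rat>. ennreal (cmod (truncated_cauchy (complex_measure_of M) \<epsilon> z)))"
  unfolding cauchy_maximal_def
proof (rule antisym)
  let ?T = "\<lambda>\<epsilon>. ennreal (cmod (truncated_cauchy (complex_measure_of M) \<epsilon> z))"
  show "(SUP \<epsilon> \<in> {0<..} \<inter> \<rat>. ?T \<epsilon>) \<le> (SUP \<epsilon> \<in> {0<..}. ?T \<epsilon>)"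
    by (intro SUP_subset_mono) auto
  show "(SUP \<epsilon> \<in> {0<..}. ?T \<epsilon>) \<le> (SUP \<epsilon> \<in> {0<..} \<inter> \<rat>. ?T \<epsilon>)"
  proof (rule SUP_least)
    fix \<epsilon> :: real assume "\<epsilon> \<in> {0<..}"
    then have "\<epsilon> > 0" by simp
    \<comment> \<open>The rational radii approach \<epsilon> from above because the continuity is
      one-sided.\<close>
    have "\<forall>n. \<exists>q\<in>\<rat>. \<epsilon> < q \<and> q < \<epsilon> + 1 / real (Suc n)"
      by (intro allI Rats_dense_in_real) simp
    then obtain r where r: "\<And>n. r n \<in> \<rat>" "\<And>n. \<epsilon> < r n" "\<And>n. r n < \<epsilon> + 1 / real (Suc n)"
      by metis
    have "(\<lambda>n. \<epsilon> + 1 / real (Suc n)) \<longlonglongrightarrow> \<epsilon> + 0"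
      by (intro tendsto_intros LIMSEQ_Suc[OF lim_1_over_n])
    then have lim: "(\<lambda>n. \<epsilon> + 1 / real (Suc n)) \<longlonglongrightarrow> \<epsilon>"
      by (simp only: add_0_right)
    have "r \<longlonglongrightarrow> \<epsilon>"
      by (rule tendsto_sandwich[OF _ _ tendsto_const lim])
        (intro always_eventually allI less_imp_le r)+
    then have "(\<lambda>n. ?T (r n)) \<longlonglongrightarrow> ?T \<epsilon>"
      using r(2) \<open>\<epsilon> > 0\<close>
      by (intro tendsto_ennrealI tendsto_norm truncated_cauchy_tendsto_from_above assms) auto
    then show "?T \<epsilon> \<le> (SUP \<epsilon> \<in> {0<..} \<inter> \<rat>. ?T \<epsilon>)"
    proof (rule LIMSEQ_le_const2, intro exI allI impI)
      fix n
      show "?T (r n) \<le> (SUP \<epsilon> \<in> {0<..} \<inter> \<rat>. ?T \<epsilon>)"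
        using r(1,2)[of n] \<open>\<epsilon> > 0\<close> by (intro SUP_upper) auto
    qed
  qed
qed

lemma borel_measurable_cauchy_maximal:
  assumes "finite_measure M" "sets M = sets borel"
  shows "cauchy_maximal (complex_measure_of M) \<in> borel_measurable borel"
proof -
  note borel_measurable_truncated_cauchy[OF assms, measurable]
  show ?thesis
    unfolding cauchy_maximal_eq_SUP_Rats[OF assms, abs_def]
    by (intro borel_measurable_SUP countable_Int2 countable_rat) measurable
qed

lemma complex_borel_measure_complex_measure_of:
  assumes "finite_measure M" "sets M = sets borel"
  shows "complex_borel_measure (complex_measure_of M)"
proof -
  interpret finite_measure M by fact
  show ?thesis
    unfolding complex_borel_measure_def complex_measure_of_def
    using finite_measure_UNION by (auto intro!: sums_of_real simp: assms(2))
qed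

subsection \<open>The primitive of the Cauchy kernel against the arcsine density\<close>

abbreviation arcsine_density :: "real \<Rightarrow> real" where
  "arcsine_density t \<equiv> indicator {-1..1} t * (1 / pi * (1 - t\<^sup>2) powr (-1/2))"

text \<open>At t = 1 and t = -1 both sides take the default value 0, since
  \<open>0 powr a = 0\<close> and \<open>1 / 0 = 0\<close>.\<close>

lemma arcsine_density_eq:
  "arcsine_density t = indicator {-1..1} t * (1 / (pi * sqrt (1 - t\<^sup>2)))"
proof (cases "t\<^sup>2 = 1")
  case False
  then show ?thesis
    by (auto simp: indicator_def powr_minus_divide powr_half_sqrt abs_square_le_1 abs_le_iff)
qed simp

lemma arcsine_density_has_integral:
  assumes "-1 \<le> a" "a \<le> b" "b \<le> 1"
  shows "(arcsine_density has_integral (arcsin b - arcsin a) / pi) {a..b}"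
proof -
  have "(arcsine_density has_integral arcsin b / pi - arcsin a / pi) {a..b}"
  \<comment> \<open>The interval may reach -1 or 1, where arcsin is continuous but not
    differentiable, so derivatives are taken in the interior only.\<close>
  proof (rule fundamental_theorem_of_calculus_interior)
    show "continuous_on {a..b} (\<lambda>t. arcsin t / pi)"
      using assms by (intro continuous_intros) auto
    show "((\<lambda>t. arcsin t / pi) has_vector_derivative arcsine_density t) (at t)"
      if "t \<in> {a<..<b}" for t
      using that assms unfolding has_real_derivative_iff_has_vector_derivative[symmetric] arcsine_density_eq
      by (auto intro!: derivative_eq_intros simp: field_simps)
  qed (use assms in simp)
  then show ?thesis
    by (simp add: diff_divide_distrib)
qed

text \<open>
  With \<open>x = cos \<theta>\<close> and \<open>t = cos s\<close> this is \<open>ln \<bar>sin ((s + \<theta>)/2) / sin ((s - \<theta>)/2)\<bar>\<close>.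
\<close>

definition arcsine_primitive :: "real \<Rightarrow> real \<Rightarrow> real" where
  "arcsine_primitive x t =
     ln (1 - x * t + sqrt (1 - x\<^sup>2) * sqrt (1 - t\<^sup>2)) - ln ((t - x)\<^sup>2) / 2"

lemma one_minus_mult_pos:
  fixes x t :: real
  assumes "\<bar>x\<bar> < 1" "\<bar>t\<bar> \<le> 1"
  shows "0 < 1 - x * t"
proof -
  have "\<bar>x * t\<bar> \<le> \<bar>x\<bar> * 1"
    unfolding abs_mult using assms by (intro mult_left_mono) auto
  then show ?thesis using assms by linarith
qed

text \<open>Cauchy-Schwarz for the unit vectors built from x and t. The argument of the first
  logarithm is thus positive and comparable to 1 - x t within a factor 2.\<close>

lemma arcsine_primitive_numerator_bounds:
  assumes "\<bar>x\<bar> < 1" "\<bar>t\<bar> \<le> 1"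
  shows "1 - x * t \<le> 1 - x * t + sqrt (1 - x\<^sup>2) * sqrt (1 - t\<^sup>2)"
    and "1 - x * t + sqrt (1 - x\<^sup>2) * sqrt (1 - t\<^sup>2) \<le> 2 * (1 - x * t)"
proof -
  have nn: "0 \<le> 1 - x\<^sup>2" "0 \<le> 1 - t\<^sup>2"
    using assms by (auto simp: abs_square_le_1)
  then show "1 - x * t \<le> 1 - x * t + sqrt (1 - x\<^sup>2) * sqrt (1 - t\<^sup>2)"
    by simp
  have "sqrt (1 - x\<^sup>2) * sqrt (1 - t\<^sup>2) \<le> 1 - x * t"
    unfolding real_sqrt_mult[symmetric]
  proof (rule real_le_lsqrt)
    show "0 \<le> 1 - x * t" using one_minus_mult_pos[OF assms] by simp
    \<comment> \<open>The right side exceeds the left by exactly (x - t)^2.\<close>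
    show "(1 - x\<^sup>2) * (1 - t\<^sup>2) \<le> (1 - x * t)\<^sup>2"
      using zero_le_power2[of "x - t"] by (simp add: power2_eq_square algebra_simps)
  qed
  then show "1 - x * t + sqrt (1 - x\<^sup>2) * sqrt (1 - t\<^sup>2) \<le> 2 * (1 - x * t)"
    by (simp add: algebra_simps)
qed

text \<open>This symmetry reduces the uniform bound to x >= 0.\<close>

lemma arcsine_primitive_minus: "arcsine_primitive (- x) (- t) = arcsine_primitive x t"
  by (simp add: arcsine_primitive_def power2_commute)

text \<open>The square root in t vanishes at both ends, leaving |t - x| inside the first logarithm,
  which cancels the second. Only the truncation points then contribute to a truncated
  integral.\<close>

lemma arcsine_primitive_endpoints:
  assumes "\<bar>x\<bar> < 1"
  shows "arcsine_primitive x 1 = 0" "arcsine_primitive x (-1) = 0"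
proof -
  have "ln ((1 - x)\<^sup>2) = 2 * ln (1 - x)" "ln ((1 + x)\<^sup>2) = 2 * ln (1 + x)"
    using assms by (auto intro!: ln_realpow[where n = 2, simplified])
  moreover have "(-1 - x)\<^sup>2 = (1 + x)\<^sup>2" 
    by (simp add: power2_eq_square algebra_simps)
  ultimately show "arcsine_primitive x 1 = 0" "arcsine_primitive x (-1) = 0"
    by (auto simp: arcsine_primitive_def)
qed

lemma arcsine_primitive_has_derivative:
  assumes "\<bar>x\<bar> < 1" "\<bar>t\<bar> < 1" "t \<noteq> x"
  shows "((\<lambda>t. - arcsine_primitive x t / (pi * sqrt (1 - x\<^sup>2))) has_real_derivative
           arcsine_density t / (t - x)) (at t)"
proof -
  define w where "w = sqrt (1 - x\<^sup>2)"
  define r where "r = sqrt (1 - t\<^sup>2)"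
  define N where "N = 1 - x * t + w * r"
  have pos: "0 < w" "0 < r" and sq: "w\<^sup>2 = 1 - x\<^sup>2" "r\<^sup>2 = 1 - t\<^sup>2"
    using assms by (auto simp: w_def r_def abs_square_less_1 abs_square_le_1)
  have N: "0 < N"
    using one_minus_mult_pos[of x t] assms pos by (simp add: N_def add_pos_pos)
  have t1: "0 < 1 - t\<^sup>2" using assms by (simp add: abs_square_less_1)
  have dr: "((\<lambda>t. sqrt (1 - t\<^sup>2)) has_real_derivative - t / r) (at t)"
  proof -
    have "((\<lambda>t. 1 - t\<^sup>2) has_real_derivative - (2 * t)) (at t)"
      by (rule derivative_eq_intros refl | simp)+
    then have "((\<lambda>t. sqrt (1 - t\<^sup>2)) has_real_derivative inverse r / 2 * - (2 * t)) (at t)"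
      unfolding r_def by (rule DERIV_real_sqrt[THEN DERIV_chain2, rotated]) (rule t1)
    then show ?thesis
      by (simp add: field_simps)
  qed
  have "((\<lambda>t. 1 - x * t + w * sqrt (1 - t\<^sup>2)) has_real_derivative - x - w * t / r) (at t)"
    by (rule derivative_eq_intros dr refl | simp)+
  from DERIV_ln_divide[THEN DERIV_chain2, OF _ this] N
  have "((\<lambda>t. ln (1 - x * t + w * sqrt (1 - t\<^sup>2))) has_real_derivative (- x - w * t / r) / N) (at t)"
    by (simp add: N_def r_def)
  \<comment> \<open>Half the logarithm of the square is ln |t - x|, so one computation serves both
    sides of x.\<close>
  moreover have "((\<lambda>t. ln ((t - x)\<^sup>2) / 2) has_real_derivative 1 / (t - x)) (at t)"
  proof -
    have "((\<lambda>t. (t - x)\<^sup>2) has_real_derivative 2 * (t - x)) (at t)"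
      by (rule derivative_eq_intros refl | simp)+
    from DERIV_cdivide[OF DERIV_ln_divide[THEN DERIV_chain2, OF _ this], of 2] assms
    have "((\<lambda>t. ln ((t - x)\<^sup>2) / 2) has_real_derivative 1 / (t - x)\<^sup>2 * (2 * (t - x)) / 2) (at t)"
      by simp
    moreover have "1 / u\<^sup>2 * (2 * u) / 2 = 1 / u" for u :: real
      by (simp add: power2_eq_square)
    ultimately show ?thesis by metis
  qed
  ultimately have "(arcsine_primitive x has_real_derivative
           (- x - w * t / r) / N - 1 / (t - x)) (at t)"
    unfolding arcsine_primitive_def w_def[symmetric] by (rule DERIV_diff)
  moreover have "(- x - w * t / r) / N - 1 / (t - x) = - w / (r * (t - x))"
  proof -
    \<comment> \<open>The result of clearing the denominators r, N and t - x; it holds modulo the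
      two relations in \<open>sq\<close>.\<close>
    have "(- x * r - w * t) * (t - x) - N * r = - w * N"
    proof -
      have "(- x * r - w * t) * (t - x) - N * r + w * N
          = r * (x\<^sup>2 + w\<^sup>2 - 1) + w * (1 - t\<^sup>2 - r\<^sup>2)"
        by (simp add: N_def power2_eq_square algebra_simps)
      then show ?thesis by (simp add: sq)
    qed
    then show ?thesis
      using pos N assms by (simp add: divide_simps) (simp add: algebra_simps)
  qed
  ultimately have "(arcsine_primitive x has_real_derivative - w / (r * (t - x))) (at t)"
    by simp
  from DERIV_cdivide[OF DERIV_minus[OF this], of "pi * w"]
  have "((\<lambda>t. - arcsine_primitive x t / (pi * w)) has_real_derivative
      - (- w / (r * (t - x))) / (pi * w)) (at t)" .
  moreover have "arcsine_density t = 1 / (pi * r)"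
    unfolding arcsine_density_eq using assms by (simp add: r_def abs_less_iff)
  ultimately show ?thesis
    using pos by (simp add: w_def[symmetric] ac_simps)
qed

lemma continuous_on_arcsine_primitive:
  assumes "\<bar>x\<bar> < 1" "A \<subseteq> {-1..1} - {x}"
  shows "continuous_on A (arcsine_primitive x)"
proof -
  have "0 < 1 - x * t + sqrt (1 - x\<^sup>2) * sqrt (1 - t\<^sup>2)" if "t \<in> A" for t
    using arcsine_primitive_numerator_bounds(1)[of x t] one_minus_mult_pos[of x t] assms that
    by (force simp: abs_le_iff)
  then show ?thesis
    unfolding arcsine_primitive_def
    using assms by (intro continuous_intros) (auto simp: less_imp_neq[symmetric])
qed

text \<open>The fundamental theorem gives only a gauge integral, since the density may blow up at an
  end of the interval. On an interval avoiding x the kernel has constant sign, which upgrades this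
  to Lebesgue integrability.\<close>

lemma arcsine_kernel_has_bochner_integral:
  assumes "\<bar>x\<bar> < 1" "-1 \<le> a" "a \<le> b" "b \<le> 1" "x \<notin> {a..b}"
  shows "has_bochner_integral lborel (\<lambda>t. indicator {a..b} t * (arcsine_density t / (t - x)))
           ((arcsine_primitive x a - arcsine_primitive x b) / (pi * sqrt (1 - x\<^sup>2)))"
proof -
  have hi: "((\<lambda>t. arcsine_density t / (t - x)) has_integral
          - arcsine_primitive x b / (pi * sqrt (1 - x\<^sup>2)) -
          - arcsine_primitive x a / (pi * sqrt (1 - x\<^sup>2))) {a..b}"
    using assms
    by (intro fundamental_theorem_of_calculus_interior continuous_intros
          continuous_on_arcsine_primitive
          arcsine_primitive_has_derivative[unfolded has_real_derivative_iff_has_vector_derivative])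
       (auto simp: abs_square_eq_1)
  have "(\<lambda>t. arcsine_density t / (t - x)) absolutely_integrable_on {a..b}"
  proof (cases "x < a")
    case True
    then show ?thesis
      using hi by (intro nonnegative_absolutely_integrable_1) (auto simp: integrable_on_def)
  next
    case False
    then have "b < x" using assms by auto
    then have "(\<lambda>t. - (arcsine_density t / (t - x))) absolutely_integrable_on {a..b}"
      using hi
    proof (intro nonnegative_absolutely_integrable_1 integrable_neg)
      fix t assume "t \<in> {a..b}"
      with \<open>b < x\<close> show "0 \<le> - (arcsine_density t / (t - x))"
        by (subst neg_0_le_iff_le, intro divide_nonneg_nonpos) auto
    qed (auto simp: integrable_on_def)
    then show ?thesis
      by (simp add: set_integrable_def)
  qed
  \<comment> \<open>Absolute integrability refers to the completed measure; a Borel measurable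
    integrand transfers to \<open>lborel\<close>.\<close>
  then have "set_integrable lborel {a..b} (\<lambda>t. arcsine_density t / (t - x))"
    unfolding set_integrable_def
    by (subst (asm) integrable_completion) auto
  moreover from set_borel_integral_eq_integral(2)[OF this] hi
  have "(LINT t:{a..b}|lborel. arcsine_density t / (t - x)) =
      (arcsine_primitive x a - arcsine_primitive x b) / (pi * sqrt (1 - x\<^sup>2))"
    by (simp add: integral_unique diff_divide_distrib)
  ultimately show ?thesis
    by (simp add: has_bochner_integral_iff set_integrable_def set_lebesgue_integral_def)
qed

section \<open>Differences of the primitive across its singularity\<close>

text \<open>For \<epsilon> < 1 - |x| no clipping occurs and both singular terms equal ln \<epsilon>.
  They cancel, and what remains is a difference of the function L, continuous at x.\<close>

lemma arcsine_primitive_tendsto: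
  assumes "\<bar>x\<bar> < 1"
  shows "((\<lambda>\<epsilon>. arcsine_primitive x (min 1 (x + \<epsilon>)) - arcsine_primitive x (max (-1) (x - \<epsilon>)))
           \<longlongrightarrow> 0) (at_right 0)"
proof -
  define L where "L t = ln (1 - x * t + sqrt (1 - x\<^sup>2) * sqrt (1 - t\<^sup>2))" for t
  have "0 < 1 - x * x" using assms one_minus_mult_pos[of x x] by simp
  then have "isCont L x"
    using arcsine_primitive_numerator_bounds(1)[of x x] assms unfolding L_def
    by (intro continuous_intros) auto
  then have "((\<lambda>\<epsilon>. L (x + \<epsilon>)) \<longlongrightarrow> L x) (at_right 0)" "((\<lambda>\<epsilon>. L (x - \<epsilon>)) \<longlongrightarrow> L x) (at_right 0)"
    by (rule isCont_tendsto_compose; (auto intro!: tendsto_eq_intros))+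
  from tendsto_diff[OF this] have "((\<lambda>\<epsilon>. L (x + \<epsilon>) - L (x - \<epsilon>)) \<longlongrightarrow> 0) (at_right 0)"
    by simp
  moreover have "eventually (\<lambda>\<epsilon>. \<epsilon> < 1 - \<bar>x\<bar>) (at_right 0)"
    using assms by (intro eventually_at_right_field[THEN iffD2] exI[of _ "1 - \<bar>x\<bar>"]) auto
  then have "eventually (\<lambda>\<epsilon>. L (x + \<epsilon>) - L (x - \<epsilon>) =
      arcsine_primitive x (min 1 (x + \<epsilon>)) - arcsine_primitive x (max (-1) (x - \<epsilon>))) (at_right 0)"
  proof eventually_elim
    case (elim \<epsilon>)
    then have "min 1 (x + \<epsilon>) = x + \<epsilon>" "max (-1) (x - \<epsilon>) = x - \<epsilon>" by auto
    then show ?case by (simp add: arcsine_primitive_def L_def)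
  qed
  ultimately show ?thesis
    by (rule Lim_transform_eventually)
qed

text \<open>With clipped step lengths d and e, the difference is the logarithm of N(x+d) e / (N(x-e)
  d). Replacing N by p and q costs a factor 2, and p e and q d agree within a factor 3, whence
  6.\<close>

lemma arcsine_primitive_diff_le_nonneg:
  assumes "0 \<le> x" "x < 1" "\<epsilon> > 0"
  shows "\<bar>arcsine_primitive x (min 1 (x + \<epsilon>)) - arcsine_primitive x (max (-1) (x - \<epsilon>))\<bar> \<le> ln 6"
proof -
  define d where "d = min (1 - x) \<epsilon>"
  define e where "e = min (1 + x) \<epsilon>"
  define N where "N t = 1 - x * t + sqrt (1 - x\<^sup>2) * sqrt (1 - t\<^sup>2)" for t
  have de: "0 < d" "0 < e" "d \<le> e" "d \<le> 1 - x" "e \<le> 1 + x"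
    using assms by (auto simp: d_def e_def)
  have uv: "min 1 (x + \<epsilon>) = x + d" "max (-1) (x - \<epsilon>) = x - e"
    by (auto simp: d_def e_def min_def max_def)
  have x: "\<bar>x\<bar> < 1" "\<bar>x + d\<bar> \<le> 1" "\<bar>x - e\<bar> \<le> 1"
    using assms de by (auto simp: abs_le_iff)
  define p where "p = 1 - x * (x + d)"
  define q where "q = 1 - x * (x - e)"
  have pq: "0 < p" "0 < q"
    using one_minus_mult_pos[OF x(1,2)] one_minus_mult_pos[OF x(1,3)] by (auto simp: p_def q_def)
  have N: "p \<le> N (x + d)" "N (x + d) \<le> 2 * p" "q \<le> N (x - e)" "N (x - e) \<le> 2 * q"
    using arcsine_primitive_numerator_bounds[OF x(1,2)] arcsine_primitive_numerator_bounds[OF x(1,3)]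
    by (auto simp: p_def q_def N_def)
  have key: "p * e \<le> q * d \<and> q * d \<le> 3 * (p * e)"
  \<comment> \<open>For x >= 0 the right end is clipped first. If it is not clipped, d = e and p is
    compared with q; otherwise x + d = 1, so p = d and the claim becomes e <= q <= 3 e.\<close>
  proof (cases "\<epsilon> \<le> 1 - x")
    case True
    then have eq: "d = \<epsilon>" "e = \<epsilon>"
      using assms by (auto simp: d_def e_def)
    have "x * \<epsilon> \<le> x * (1 - x)"
      using True assms by (intro mult_left_mono) auto
    moreover have "x * (1 - x) \<le> 1 * (1 - x)"
      using assms by (intro mult_right_mono) auto
    ultimately have "p \<le> q" "q \<le> 3 * p"
      using assms by (auto simp: p_def q_def eq algebra_simps)
    then show ?thesis
      using assms by (auto simp: eq intro: mult_right_mono)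
  next
    case False
    then have d: "d = 1 - x" by (simp add: d_def)
    then have p: "p = d" by (simp add: p_def)
    have "(1 - x) * e \<le> (1 - x) * (1 + x)"
      using assms de by (intro mult_left_mono) auto
    moreover have "(1 + x) * (1 - x) \<le> (1 + x) * e"
      using assms de d by (intro mult_left_mono) auto
    moreover have "x * e \<le> 1 * e"
      using assms de by (intro mult_right_mono) auto
    ultimately have "e \<le> q" "q \<le> 3 * e"
      by (auto simp: q_def algebra_simps)
    then show ?thesis
      using de by (auto simp: p mult.commute)
  qed
  have pos: "0 < N (x + d)" "0 < N (x - e)"
    using N pq by linarith+
  have "N (x + d) * e \<le> 2 * p * e" "q * d \<le> N (x - e) * d"
    "N (x - e) * d \<le> 2 * q * d" "p * e \<le> N (x + d) * e"
    using N de by (intro mult_right_mono; simp)+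
  with key have "N (x + d) * e \<le> 2 * (N (x - e) * d)" "N (x - e) * d \<le> 6 * (N (x + d) * e)"
    by linarith+
  moreover have "0 < N (x + d) * e" "0 < N (x - e) * d"
    using pos de by auto
  ultimately have "N (x + d) * e \<le> 6 * (N (x - e) * d)" "N (x - e) * d \<le> 6 * (N (x + d) * e)"
    by linarith+
  then have "ln (N (x + d) * e) \<le> ln (6 * (N (x - e) * d))" "ln (N (x - e) * d) \<le> ln (6 * (N (x + d) * e))"
    using pos de by (simp_all add: ln_le_cancel_iff)
  then have "\<bar>(ln (N (x + d)) + ln e) - (ln (N (x - e)) + ln d)\<bar> \<le> ln 6"
    using pos de by (simp add: ln_mult_pos abs_le_iff)
  moreover have "arcsine_primitive x (x + d) = ln (N (x + d)) - ln d"
    "arcsine_primitive x (x - e) = ln (N (x - e)) - ln e"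
    using de by (simp_all add: arcsine_primitive_def N_def ln_realpow)
  ultimately show ?thesis
    unfolding uv by (simp add: algebra_simps)
qed

lemma arcsine_primitive_diff_le:
  assumes "\<bar>x\<bar> < 1" "\<epsilon> > 0"
  shows "\<bar>arcsine_primitive x (min 1 (x + \<epsilon>)) - arcsine_primitive x (max (-1) (x - \<epsilon>))\<bar> \<le> ln 6"
proof (cases "0 \<le> x")
  case True
  then show ?thesis using assms by (intro arcsine_primitive_diff_le_nonneg) auto
next
  case False
  \<comment> \<open>Reflection swaps the two clipped truncation points, so the difference only
    changes sign.\<close>
  have "- min 1 (- x + \<epsilon>) = max (-1) (x - \<epsilon>)" "- max (-1) (- x - \<epsilon>) = min 1 (x + \<epsilon>)"
    by (auto simp: min_def max_def)
  then have "arcsine_primitive (- x) (min 1 (- x + \<epsilon>)) = arcsine_primitive x (max (-1) (x - \<epsilon>))"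
    "arcsine_primitive (- x) (max (-1) (- x - \<epsilon>)) = arcsine_primitive x (min 1 (x + \<epsilon>))"
    using arcsine_primitive_minus[of x] by (metis minus_minus)+
  then show ?thesis
    using arcsine_primitive_diff_le_nonneg[of "- x" \<epsilon>] assms False by (simp add: abs_minus_commute)
qed

subsection \<open>The arcsine measure\<close>

lemma sets_arcsine_measure [simp, measurable_cong]: "sets arcsine_measure = sets borel"
  and space_arcsine_measure [simp]: "space arcsine_measure = UNIV"
  by (simp_all add: arcsine_measure_def)

lemma emeasure_arcsine_measure:
  assumes [measurable]: "A \<in> sets borel"
  shows "emeasure arcsine_measure A =
    (\<integral>\<^sup>+ t. ennreal (arcsine_density t) * indicator A (complex_of_real t) \<partial>lborel)"
proof -
  have "complex_of_real -` A \<in> sets borel"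
    using measurable_sets[of complex_of_real borel borel A] by simp
  then have "emeasure arcsine_measure A =
      (\<integral>\<^sup>+ t. ennreal (arcsine_density t) * indicator (complex_of_real -` A) t \<partial>lborel)"
    unfolding arcsine_measure_def
    by (subst emeasure_distr, simp_all, subst emeasure_density) simp_all
  then show ?thesis
    by (simp add: indicator_vimage[abs_def])
qed

lemma nn_integral_arcsine_density:
  assumes "-1 \<le> a" "a \<le> b" "b \<le> 1"
  shows "(\<integral>\<^sup>+ t. ennreal (arcsine_density t) * indicator {a..b} t \<partial>lborel) =
    ennreal ((arcsin b - arcsin a) / pi)"
  by (intro nn_integral_has_integral_lebesgue' arcsine_density_has_integral assms) simp

lemma emeasure_arcsine_measure_UNIV: "emeasure arcsine_measure UNIV = 1"
proof -
  have "emeasure arcsine_measure UNIV =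
      (\<integral>\<^sup>+ t. ennreal (arcsine_density t) * indicator {-1..1} t \<partial>lborel)"
    by (subst emeasure_arcsine_measure) (auto intro!: nn_integral_cong simp: indicator_def)
  also have "\<dots> = 1"
    by (subst nn_integral_arcsine_density) simp_all
  finally show ?thesis .
qed

lemma finite_measure_arcsine_measure: "finite_measure arcsine_measure"
  by (rule finite_measureI) (simp add: emeasure_arcsine_measure_UNIV)

lemma AE_arcsine_measure: "AE z in arcsine_measure. Im z = 0 \<and> \<bar>Re z\<bar> < 1"
proof -
  \<comment> \<open>The density has the default value 0 at 1 and -1, so the set where it is positive
    lies in the open interval.\<close>
  have "0 < arcsine_density t \<longrightarrow> \<bar>t\<bar> < 1" for t
    by (cases "t = 1 \<or> t = -1") (auto simp: indicator_def abs_less_iff)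
  then show ?thesis
    unfolding arcsine_measure_def by (subst AE_distr_iff) (auto simp: AE_density)
qed

lemma emeasure_arcsine_measure_singleton: "emeasure arcsine_measure {z} = 0"
proof -
  have "AE t in lborel. t \<noteq> Re z"
    by (rule AE_lborel_singleton)
  then have "AE t in lborel. ennreal (arcsine_density t) * indicator {z} (complex_of_real t) = 0"
    by eventually_elim (auto simp: indicator_def)
  then show ?thesis
    by (subst emeasure_arcsine_measure) (simp_all add: nn_integral_0_iff_AE)
qed

text \<open>Within [-1,1] the set lies in two end intervals, each of mass (pi/2 - arcsin c)/pi =
  (arcsin q)/pi. For q >= 1/2 the total mass 1 suffices.\<close>

lemma emeasure_arcsine_measure_near_endpoints:
  assumes "q > 0"
  shows "emeasure arcsine_measure {z. sqrt (1 - (Re z)\<^sup>2) < q} \<le> ennreal (2 * q)"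
proof (cases "q < 1 / 2")
  case False
  have "emeasure arcsine_measure {z. sqrt (1 - (Re z)\<^sup>2) < q} \<le> emeasure arcsine_measure UNIV"
    by (intro emeasure_mono) auto
  also have "\<dots> \<le> ennreal (2 * q)"
    using False by (simp add: emeasure_arcsine_measure_UNIV)
  finally show ?thesis .
next
  case True
  define c where "c = sqrt (1 - q\<^sup>2)"
  have "q\<^sup>2 \<le> (1 / 2)\<^sup>2"
    using True assms by (intro power_mono) auto
  then have q2: "q\<^sup>2 \<le> 1 / 4" by (simp add: power2_eq_square)
  have c: "1 / 2 \<le> c" "c \<le> 1"
    unfolding c_def using q2 by (intro real_le_rsqrt; simp add: power2_eq_square) simp
  \<comment> \<open>From c >= 1/2 this chain yields arcsin q <= q/c <= 2 q.\<close>
  have "arcsin q = arctan (q / c)"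
    using True assms by (simp add: arcsin_arctan c_def)
  also have "\<dots> \<le> q / c"
    using assms c by (intro arctan_le_self) auto
  also have "\<dots> \<le> q / (1 / 2)"
    using assms c by (intro divide_left_mono) auto
  finally have "arcsin q \<le> 2 * q" by simp
  moreover have "arcsin c = pi / 2 - arcsin q"
    using True assms c arccos_arcsin_eq[of c] arcsin_arccos_sqrt_pos[of q] by (simp add: c_def)
  ultimately have arcsin_c: "pi / 2 - arcsin c \<le> 2 * q" by simp
  have "emeasure arcsine_measure {z. sqrt (1 - (Re z)\<^sup>2) < q} =
      (\<integral>\<^sup>+ t. ennreal (arcsine_density t) * indicator {z. sqrt (1 - (Re z)\<^sup>2) < q} (complex_of_real t) \<partial>lborel)"
    by (rule emeasure_arcsine_measure) measurable
  also have "\<dots> \<le> (\<integral>\<^sup>+ t. ennreal (arcsine_density t) * indicator {-1..-c} t +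
      ennreal (arcsine_density t) * indicator {c..1} t \<partial>lborel)"
  proof (rule nn_integral_mono)
    fix t :: real
    \<comment> \<open>Where |t| > 1 the square root is negative and its bound holds trivially, but
      the density vanishes there.\<close>
    have "t \<in> {-1..-c} \<union> {c..1}" if "sqrt (1 - t\<^sup>2) < q" "t \<in> {-1..1}"
    proof -
      have "1 - t\<^sup>2 \<le> q\<^sup>2"
        using that assms by (intro sqrt_le_D) auto
      then have "c \<le> \<bar>t\<bar>"
        unfolding c_def by (intro real_le_lsqrt) auto
      then show ?thesis using that by auto
    qed
    then show "ennreal (arcsine_density t) * indicator {z. sqrt (1 - (Re z)\<^sup>2) < q} (complex_of_real t)
      \<le> ennreal (arcsine_density t) * indicator {-1..-c} t + ennreal (arcsine_density t) * indicator {c..1} t"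
      by (cases "t \<in> {-1..1}"; cases "sqrt (1 - t\<^sup>2) < q") (auto simp: indicator_def)
  qed
  also have "\<dots> = ennreal ((arcsin (-c) - arcsin (-1)) / pi) + ennreal ((arcsin 1 - arcsin c) / pi)"
    using c nn_integral_arcsine_density[of "-1" "-c"] nn_integral_arcsine_density[of c 1]
    by (subst nn_integral_add) simp_all
  also have "\<dots> = ennreal (2 * (pi / 2 - arcsin c) / pi)"
    using c arcsin_ubound[of c]
    by (subst ennreal_plus[symmetric]) (auto simp: arcsin_minus add_divide_distrib diff_divide_distrib)
  also have "\<dots> \<le> ennreal (2 * q)"
  proof (rule ennreal_leI)
    have "2 * (pi / 2 - arcsin c) \<le> 4 * q"
      using arcsin_c by simp
    also have "\<dots> \<le> 2 * q * pi"
      using pi_ge_two assms by simp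
    finally show "2 * (pi / 2 - arcsin c) / pi \<le> 2 * q"
      by (simp add: divide_le_eq)
  qed
  finally show ?thesis .
qed

section \<open>Truncated Cauchy integrals of the arcsine measure\<close>

lemma truncated_cauchy_arcsine:
  assumes x: "\<bar>x\<bar> < 1" and \<epsilon>: "\<epsilon> > 0"
  shows "truncated_cauchy (complex_measure_of arcsine_measure) \<epsilon> (complex_of_real x) =
    complex_of_real ((arcsine_primitive x (min 1 (x + \<epsilon>)) - arcsine_primitive x (max (-1) (x - \<epsilon>)))
      / (pi * sqrt (1 - x\<^sup>2)))"
proof -
  define a where "a = min 1 (x + \<epsilon>)"
  define b where "b = max (-1) (x - \<epsilon>)"
  define k where "k t = arcsine_density t / (t - x)" for t
  define f where "f t = arcsine_density t * (if \<bar>t - x\<bar> > \<epsilon> then 1 / (t - x) else 0)" for t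
  have [measurable]: "k \<in> borel_measurable borel" "f \<in> borel_measurable borel"
    unfolding k_def f_def by measurable
  have "has_bochner_integral lborel (\<lambda>t. indicator {a..1} t * k t + indicator {-1..b} t * k t)
      ((arcsine_primitive x a - arcsine_primitive x 1) / (pi * sqrt (1 - x\<^sup>2)) +
       (arcsine_primitive x (-1) - arcsine_primitive x b) / (pi * sqrt (1 - x\<^sup>2)))"
    unfolding k_def using assms
    by (intro has_bochner_integral_add arcsine_kernel_has_bochner_integral) (auto simp: a_def b_def)
  then have "(\<integral>t. indicator {a..1} t * k t + indicator {-1..b} t * k t \<partial>lborel) =
      (arcsine_primitive x a - arcsine_primitive x b) / (pi * sqrt (1 - x\<^sup>2))"
    using x by (simp add: has_bochner_integral_integral_eq arcsine_primitive_endpoints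
        add_divide_distrib[symmetric] diff_divide_distrib[symmetric])
  moreover have "(\<integral>t. indicator {a..1} t * k t + indicator {-1..b} t * k t \<partial>lborel) = integral\<^sup>L lborel f"
  proof (rule integral_cong_AE)
    \<comment> \<open>The closed intervals and the strict truncation differ at most at a and b. If
      clipping occurs, the interval in question degenerates to that single point.\<close>
    have "AE t in lborel. t \<noteq> a" "AE t in lborel. t \<noteq> b"
      by (rule AE_lborel_singleton)+
    then show "AE t in lborel. indicator {a..1} t * k t + indicator {-1..b} t * k t = f t"
    proof eventually_elim
      case (elim t)
      show ?case
      proof (cases "t \<in> {-1..1}")
        case True
        then have "t \<in> {a..1} \<longleftrightarrow> t > x + \<epsilon>" "t \<in> {-1..b} \<longleftrightarrow> t < x - \<epsilon>"
          using elim by (auto simp: a_def b_def)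
        then show ?thesis
          using \<epsilon> by (auto simp: k_def f_def indicator_def)
      qed (simp add: k_def f_def)
    qed
  qed measurable
  moreover have "truncated_cauchy (complex_measure_of arcsine_measure) \<epsilon> (complex_of_real x) =
      complex_of_real (integral\<^sup>L lborel f)"
  proof -
    have "truncated_cauchy (complex_measure_of arcsine_measure) \<epsilon> (complex_of_real x) =
       (\<integral>\<zeta>. (if cmod (\<zeta> - x) > \<epsilon> then 1 / (\<zeta> - x) else 0) \<partial>arcsine_measure)"
      by (rule truncated_cauchy_complex_measure_of[OF finite_measure_arcsine_measure]) simp
    also have "\<dots> = (\<integral>t. arcsine_density t *\<^sub>R
        (if cmod (complex_of_real t - x) > \<epsilon> then 1 / (complex_of_real t - x) else 0) \<partial>lborel)"
      unfolding arcsine_measure_def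
      by (subst integral_distr, simp, simp, subst integral_density) simp_all
    also have "\<dots> = (\<integral>t. complex_of_real (f t) \<partial>lborel)"
      by (intro Bochner_Integration.integral_cong)
        (auto simp: f_def scaleR_conv_of_real of_real_diff[symmetric] simp del: of_real_diff)
    finally show ?thesis by simp
  qed
  ultimately show ?thesis
    by (simp add: a_def b_def)
qed

lemma cauchy_transform_arcsine_tendsto:
  assumes "\<bar>x\<bar> < 1"
  shows "((\<lambda>\<epsilon>. truncated_cauchy (complex_measure_of arcsine_measure) \<epsilon> (complex_of_real x)) \<longlongrightarrow> 0)
    (at_right 0)"
proof (rule Lim_transform_eventually)
  show "((\<lambda>\<epsilon>. complex_of_real ((arcsine_primitive x (min 1 (x + \<epsilon>)) -
      arcsine_primitive x (max (-1) (x - \<epsilon>))) / (pi * sqrt (1 - x\<^sup>2)))) \<longlongrightarrow> 0) (at_right 0)"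
    using tendsto_of_real[OF tendsto_divide_zero[OF arcsine_primitive_tendsto[OF assms]]]
    by (simp only: of_real_0)
  show "\<forall>\<^sub>F \<epsilon> in at_right 0. complex_of_real ((arcsine_primitive x (min 1 (x + \<epsilon>)) -
      arcsine_primitive x (max (-1) (x - \<epsilon>))) / (pi * sqrt (1 - x\<^sup>2))) =
    truncated_cauchy (complex_measure_of arcsine_measure) \<epsilon> (complex_of_real x)"
    using eventually_at_right_less[of 0]
    by eventually_elim (simp only: truncated_cauchy_arcsine[OF assms])
qed

lemma cauchy_maximal_arcsine_le:
  assumes "\<bar>x\<bar> < 1"
  shows "cauchy_maximal (complex_measure_of arcsine_measure) (complex_of_real x)
    \<le> ennreal (ln 6 / (pi * sqrt (1 - x\<^sup>2)))"
  unfolding cauchy_maximal_def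
proof (intro SUP_least ennreal_leI)
  fix \<epsilon> :: real assume "\<epsilon> \<in> {0<..}"
  moreover have "0 \<le> 1 - x\<^sup>2" using assms by (simp add: abs_square_le_1)
  ultimately show "cmod (truncated_cauchy (complex_measure_of arcsine_measure) \<epsilon> (complex_of_real x))
      \<le> ln 6 / (pi * sqrt (1 - x\<^sup>2))"
    using arcsine_primitive_diff_le[OF assms, of \<epsilon>]
    by (simp add: truncated_cauchy_arcsine[OF assms] norm_of_real abs_mult divide_right_mono
        del: of_real_divide of_real_diff)
qed

section \<open>Reflectionlessness and the weak-type estimate\<close>

lemma reflectionless_arcsine: "reflectionless (complex_measure_of arcsine_measure)"
  unfolding reflectionless_def
proof (intro conjI allI)
  show "complex_borel_measure (complex_measure_of arcsine_measure)"
    by (simp add: complex_borel_measure_complex_measure_of finite_measure_arcsine_measure)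
  have "complex_measure_of arcsine_measure UNIV = 1"
    by (simp add: complex_measure_of_def measure_def emeasure_arcsine_measure_UNIV)
  then show "\<exists>E\<in>sets borel. complex_measure_of arcsine_measure E \<noteq> 0"
    by (intro bexI[of _ UNIV]) auto
  show "complex_measure_of arcsine_measure {z} = 0" for z
    by (simp add: complex_measure_of_def measure_def emeasure_arcsine_measure_singleton)
  show "AE z in total_variation (complex_measure_of arcsine_measure).
      cauchy_transform_exists (complex_measure_of arcsine_measure) z \<and>
      cauchy_transform (complex_measure_of arcsine_measure) z = 0"
    unfolding total_variation_complex_measure_of[OF finite_measure_arcsine_measure sets_arcsine_measure]
    using AE_arcsine_measure
  proof eventually_elim
    case (elim z)
    then have "z = complex_of_real (Re z)" by (simp add: complex_eq_iff)
    with elim cauchy_transform_arcsine_tendsto[of "Re z"]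
    have "((\<lambda>\<epsilon>. truncated_cauchy (complex_measure_of arcsine_measure) \<epsilon> z) \<longlongrightarrow> 0) (at_right 0)"
      by simp
    then show ?case
      unfolding cauchy_transform_exists_def cauchy_transform_def
      using tendsto_Lim[OF trivial_limit_at_right_real] by blast
  qed
qed

lemma weak_L1_cauchy_maximal_arcsine:
  "weak_L1 arcsine_measure (cauchy_maximal (complex_measure_of arcsine_measure))"
  unfolding weak_L1_def
proof (intro conjI exI allI impI)
  let ?C = "cauchy_maximal (complex_measure_of arcsine_measure)"
  have [measurable]: "?C \<in> borel_measurable borel"
    by (simp add: borel_measurable_cauchy_maximal finite_measure_arcsine_measure)
  show "?C \<in> borel_measurable arcsine_measure" by measurable
  fix t :: real assume t: "t > 0"
  \<comment> \<open>The threshold at which the pointwise bound ln 6 / (pi w) equals t.\<close>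
  define q where "q = ln 6 / (pi * t)"
  have "q > 0" using t by (simp add: q_def)
  \<comment> \<open>The pointwise bound is known only on the open segment, so the inclusion of level
    sets is almost everywhere.\<close>
  have "AE z in arcsine_measure. ennreal t < ?C z \<longrightarrow> sqrt (1 - (Re z)\<^sup>2) < q"
    using AE_arcsine_measure
  proof eventually_elim
    case (elim z)
    define w where "w = sqrt (1 - (Re z)\<^sup>2)"
    have "w > 0" using elim by (simp add: w_def abs_square_less_1)
    have "z = complex_of_real (Re z)" using elim by (simp add: complex_eq_iff)
    with elim cauchy_maximal_arcsine_le[of "Re z"] have "?C z \<le> ennreal (ln 6 / (pi * w))"
      by (simp add: w_def)
    moreover have "w < q" if "ennreal t < ennreal (ln 6 / (pi * w))"
      using that t \<open>w > 0\<close> by (simp add: ennreal_less_iff q_def field_simps)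
    ultimately show ?case
      unfolding w_def[symmetric] by (auto dest: less_le_trans)
  qed
  then have "emeasure arcsine_measure {z \<in> space arcsine_measure. ?C z > ennreal t}
      \<le> emeasure arcsine_measure {z. sqrt (1 - (Re z)\<^sup>2) < q}"
    by (intro emeasure_mono_AE) (auto elim: eventually_mono)
  also have "\<dots> \<le> ennreal (2 * q)"
    using \<open>q > 0\<close> by (rule emeasure_arcsine_measure_near_endpoints)
  \<comment> \<open>Displaying the bound as a quotient by t lets the constant be read off as 2 ln 6
    / pi, independent of t.\<close>
  also have "2 * q = 2 * ln 6 / pi / t"
    by (simp add: q_def)
  finally show "emeasure arcsine_measure {z \<in> space arcsine_measure. ?C z > ennreal t}
      \<le> ennreal (2 * ln 6 / pi / t)" .
qed

theorem mainTheorem2: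
  fixes \<mu> :: "complex set \<Rightarrow> complex"
  assumes "\<mu> = complex_measure_of arcsine_measure"
  shows "reflectionless \<mu> \<and> weak_L1 (total_variation \<mu>) (cauchy_maximal \<mu>)"
  unfolding assms
    total_variation_complex_measure_of[OF finite_measure_arcsine_measure sets_arcsine_measure]
  using reflectionless_arcsine weak_L1_cauchy_maximal_arcsine by blast

end
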